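(* Let $a,b,c\in\mathbb{Z}[i]$ be nonzero Gaussian integers that are square-free and pairwise coprime in $\mathbb{Z}[i]$. If the equation $ax^2+by^2+cz^2=0$ has a nontrivial solution in $\mathbb{Z}[i]$, that is, a solution $(x,y,z)\in\mathbb{Z}[i]^3$ with $(x,y,z)\neq(0,0,0)$, then it has a nontrivial solution $(x,y,z)\in\mathbb{Z}[i]^3$ satisfying $$|z|\leq\sqrt{(1+\sqrt{2})\,|ab|}.$$
   Context: $\mathbb{Z}[i]$ denotes the ring of Gaussian integers and $|\cdot|$ the usual complex modulus. The equation $ax^2+by^2+cz^2=0$ is said to be expressed in its normal form when $a,b,c$ are square-free (not divisible by the square of any prime of $\mathbb{Z}[i]$; in particular units are square-free) and pairwise coprime. A solution is nontrivial if it is different from $(0,0,0)$. *)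

theory Defs
  imports "HOL-Analysis.Analysis" "HOL-Computational_Algebra.Computational_Algebra"
begin

datatype gauss_int = Gauss_Int (re_gi: int) (im_gi: int)

lemma gauss_int_eq_iff: "u = v \<longleftrightarrow> re_gi u = re_gi v \<and> im_gi u = im_gi v"
  by (cases u; cases v) simp

definition complex_of_gauss :: "gauss_int \<Rightarrow> complex" where
  "complex_of_gauss u = Complex (of_int (re_gi u)) (of_int (im_gi u))"

instantiation gauss_int :: comm_ring_1
begin

definition "0 = Gauss_Int 0 0"
definition "1 = Gauss_Int 1 0"
definition "u + v = Gauss_Int (re_gi u + re_gi v) (im_gi u + im_gi v)"
definition "u - v = Gauss_Int (re_gi u - re_gi v) (im_gi u - im_gi v)"
definition "- u = Gauss_Int (- re_gi u) (- im_gi u)"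
definition "u * v = Gauss_Int (re_gi u * re_gi v - im_gi u * im_gi v)
                              (re_gi u * im_gi v + im_gi u * re_gi v)"

instance
  by standard
    (simp_all add: zero_gauss_int_def one_gauss_int_def plus_gauss_int_def minus_gauss_int_def
      uminus_gauss_int_def times_gauss_int_def gauss_int_eq_iff algebra_simps)

end

lemma complex_of_gauss_inject [simp]:
  "complex_of_gauss u = complex_of_gauss v \<longleftrightarrow> u = v"
  by (simp add: complex_of_gauss_def gauss_int_eq_iff)

lemma complex_of_gauss_ring_hom [simp]:
  "complex_of_gauss 0 = 0"
  "complex_of_gauss 1 = 1"
  "complex_of_gauss (u + v) = complex_of_gauss u + complex_of_gauss v"
  "complex_of_gauss (u - v) = complex_of_gauss u - complex_of_gauss v"
  "complex_of_gauss (- u) = - complex_of_gauss u"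
  "complex_of_gauss (u * v) = complex_of_gauss u * complex_of_gauss v"
  by (simp_all add: complex_of_gauss_def complex_eq_iff zero_gauss_int_def one_gauss_int_def
      plus_gauss_int_def minus_gauss_int_def uminus_gauss_int_def times_gauss_int_def)

lemma complex_of_gauss_eq_0_iff [simp]: "complex_of_gauss u = 0 \<longleftrightarrow> u = 0"
  using complex_of_gauss_inject[of u 0] by simp

lemma range_complex_of_gauss: "range complex_of_gauss = {z. Re z \<in> \<int> \<and> Im z \<in> \<int>}"
proof (intro equalityI subsetI)
  fix z assume "z \<in> {z. Re z \<in> \<int> \<and> Im z \<in> \<int>}"
  then obtain m n where "Re z = of_int m" "Im z = of_int n"
    by (auto elim!: Ints_cases)
  then have "z = complex_of_gauss (Gauss_Int m n)"
    by (simp add: complex_of_gauss_def complex_eq_iff)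
  then show "z \<in> range complex_of_gauss" by blast
qed (auto simp: complex_of_gauss_def)

definition gauss_norm :: "gauss_int \<Rightarrow> nat" where
  "gauss_norm u = nat ((re_gi u)\<^sup>2 + (im_gi u)\<^sup>2)"

lemma gauss_norm_cmod: "real (gauss_norm u) = (cmod (complex_of_gauss u))\<^sup>2"
  by (simp add: gauss_norm_def complex_of_gauss_def cmod_power2)

text \<open>Division rounds the complex quotient to a nearest Gaussian integer.\<close>

instantiation gauss_int :: euclidean_ring
begin

definition divide_gauss_int :: "gauss_int \<Rightarrow> gauss_int \<Rightarrow> gauss_int" where
  "u div v = (let q = complex_of_gauss u / complex_of_gauss v
              in Gauss_Int (round (Re q)) (round (Im q)))"

definition modulo_gauss_int :: "gauss_int \<Rightarrow> gauss_int \<Rightarrow> gauss_int" where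
  "(u :: gauss_int) mod v = u - u div v * v"

definition euclidean_size_gauss_int :: "gauss_int \<Rightarrow> nat" where
  "euclidean_size u = gauss_norm u"

instance
proof
  fix u v w :: gauss_int
  show "u * v div v = u" if "v \<noteq> 0"
  proof -
    have "complex_of_gauss (u * v) / complex_of_gauss v = complex_of_gauss u"
      using that by simp
    then show ?thesis
      unfolding divide_gauss_int_def Let_def by (simp add: complex_of_gauss_def)
  qed
  show "u div 0 = 0"
    unfolding divide_gauss_int_def Let_def complex_of_gauss_ring_hom
    by (simp add: zero_gauss_int_def)
  show "u div v * v + u mod v = u"
    by (simp add: modulo_gauss_int_def)
  show "u * v \<noteq> 0" if "u \<noteq> 0" "v \<noteq> 0"
  proof -
    have "complex_of_gauss (u * v) \<noteq> 0"
      unfolding complex_of_gauss_ring_hom using that by simp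
    then show ?thesis unfolding complex_of_gauss_eq_0_iff .
  qed
  show "euclidean_size (0::gauss_int) = 0"
    by (simp add: euclidean_size_gauss_int_def gauss_norm_def zero_gauss_int_def)
  show "euclidean_size (u mod v) < euclidean_size v" if v: "v \<noteq> 0"
  proof -
    define q where "q = complex_of_gauss u / complex_of_gauss v"
    define d where "d = q - complex_of_gauss (u div v)"
    have "complex_of_gauss (u mod v) = d * complex_of_gauss v"
      using v by (simp add: modulo_gauss_int_def d_def q_def field_simps)
    moreover have "\<bar>Re d\<bar> \<le> 1/2" "\<bar>Im d\<bar> \<le> 1/2"
      using of_int_round_abs_le[of "Re q"] of_int_round_abs_le[of "Im q"]
      by (simp_all add: d_def divide_gauss_int_def Let_def q_def complex_of_gauss_def
          abs_minus_commute)
    then have "(Re d)\<^sup>2 \<le> (1/2)\<^sup>2" "(Im d)\<^sup>2 \<le> (1/2)\<^sup>2"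
      by (metis abs_ge_zero power2_abs power_mono)+
    then have "(cmod d)\<^sup>2 < 1"
      unfolding cmod_power2 by (simp add: power_divide)
    ultimately have "(cmod (complex_of_gauss (u mod v)))\<^sup>2 < (cmod (complex_of_gauss v))\<^sup>2"
      using v by (simp add: norm_mult power_mult_distrib)
    then show ?thesis
      by (simp add: euclidean_size_gauss_int_def flip: gauss_norm_cmod)
  qed
  show "euclidean_size u \<le> euclidean_size (u * v)" if v: "v \<noteq> 0"
  proof -
    have "real (gauss_norm v) > 0"
      using v by (simp add: gauss_norm_cmod del: of_nat_0_less_iff)
    then have "gauss_norm v \<ge> 1" by simp
    moreover have "real (gauss_norm (u * v)) = real (gauss_norm u * gauss_norm v)"
      by (simp add: gauss_norm_cmod norm_mult power_mult_distrib)
    then have "gauss_norm (u * v) = gauss_norm u * gauss_norm v"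
      by (simp only: of_nat_eq_iff)
    ultimately show ?thesis
      by (simp add: euclidean_size_gauss_int_def)
  qed
qed

end

lemma prime_dvd_gauss_int:
  fixes x :: gauss_int
  assumes "x \<noteq> 0" "\<not> x dvd 1"
  obtains p where "prime_elem p" "p dvd x"
proof -
  let ?D = "\<lambda>p::gauss_int. p dvd x \<and> \<not> p dvd 1"
  obtain p where p: "?D p" and min: "\<And>r. ?D r \<Longrightarrow> euclidean_size p \<le> euclidean_size r"
    using ex_has_least_nat[of ?D x euclidean_size] assms by auto
  have p0: "p \<noteq> 0" using p assms(1) by auto
  have "prime_elem p"
  proof (rule prime_elemI)
    fix s t assume st: "p dvd s * t"
    show "p dvd s \<or> p dvd t"
    proof (rule disjCI)
      assume nt: "\<not> p dvd t"
      let ?I = "\<lambda>g. g \<noteq> 0 \<and> (\<exists>m n. g = m * p + n * t)"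
      have "?I p" using p0 by (intro conjI exI[of _ 1] exI[of _ 0]) auto
      then obtain g where g: "?I g" and gmin: "\<And>r. ?I r \<Longrightarrow> euclidean_size g \<le> euclidean_size r"
        using ex_has_least_nat[of ?I p euclidean_size] by auto
      from g obtain m n where mn: "g = m * p + n * t" by blast
      have dv: "g dvd r" if "r = m' * p + n' * t" for r m' n'
      proof (rule ccontr)
        assume "\<not> g dvd r"
        then have "r mod g \<noteq> 0" by (simp add: mod_eq_0_iff_dvd)
        moreover have "r mod g = (m' - r div g * m) * p + (n' - r div g * n) * t"
          unfolding modulo_gauss_int_def by (simp add: that mn algebra_simps)
        ultimately have "euclidean_size g \<le> euclidean_size (r mod g)"
          using gmin[of "r mod g"] by blast
        then show False using mod_size_less[of g r] g by auto
      qed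
      have gp: "g dvd p" using dv[of p 1 0] by simp
      have gt: "g dvd t" using dv[of t 0 1] by simp
      have "g dvd 1"
      proof (rule ccontr)
        assume "\<not> g dvd 1"
        then have "?D g" using gp p dvd_trans by blast
        then have "euclidean_size p \<le> euclidean_size g" by (rule min)
        moreover have "euclidean_size g \<le> euclidean_size p"
          using gp p0 by (intro dvd_imp_size_le)
        ultimately have "p dvd g" using dvd_euclidean_size_eq_imp_dvd[of p g] p0 gp by simp
        then show False using gt nt dvd_trans by blast
      qed
      then obtain h where "1 = g * h" by (elim dvdE)
      then have "s = s * (g * h)" by simp
      also have "\<dots> = p * (s * m * h) + (s * t) * (n * h)"
        by (simp add: mn algebra_simps)
      finally have "s = p * (s * m * h) + (s * t) * (n * h)" .
      moreover have "p dvd p * (s * m * h) + (s * t) * (n * h)"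
        using st by (intro dvd_add[OF dvd_triv_left dvd_mult2])
      ultimately show "p dvd s" by simp
    qed
  qed (use p p0 in auto)
  then show ?thesis using that p by blast
qed

lemma squarefree_gauss_int_iff:
  fixes a :: gauss_int
  assumes "a \<noteq> 0"
  shows "squarefree a \<longleftrightarrow> (\<forall>p. prime_elem p \<longrightarrow> \<not> p\<^sup>2 dvd a)"
proof
  assume "squarefree a"
  then show "\<forall>p. prime_elem p \<longrightarrow> \<not> p\<^sup>2 dvd a"
    by (auto simp: squarefree_def prime_elem_def)
next
  assume *: "\<forall>p. prime_elem p \<longrightarrow> \<not> p\<^sup>2 dvd a"
  show "squarefree a"
  proof (rule squarefreeI, rule ccontr)
    fix x assume x: "x\<^sup>2 dvd a" "\<not> x dvd 1"
    then have "x \<noteq> 0" using assms by auto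
    then obtain p where "prime_elem p" "p dvd x" using prime_dvd_gauss_int x by blast
    moreover from this have "p\<^sup>2 dvd x\<^sup>2" by (simp add: dvd_power_same)
    ultimately show False using * x dvd_trans by blast
  qed
qed

end

theory Submission
  imports Defs
begin

text \<open>
  The proof is a descent on the size of \<open>z\<close>, with chords of the conic
  \<open>a x\<^sup>2 + b y\<^sup>2 + c z\<^sup>2 = 0\<close>. A line through a known solution \<open>(x, y, z)\<close> in an integral direction
  \<open>(X, Y, Z)\<close> meets the conic in a second point. If \<open>x\<close> and \<open>y\<close> are coprime, a Bezout relation
  \<open>u x + v y = 1\<close> suggests the directions \<open>(c v, - c u, Z)\<close>: both coefficients occurring in the
  coordinates of the second point are then divisible by \<open>c\<close>, and after this factor is removed its
  last coordinate \<open>z'\<close> satisfies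
  \<open>z z' = - (m\<^sup>2 + a b)\<close> with \<open>m = (a v x - b u y) + Z z\<close> (\<open>chord_point_solution\<close>).

  The free parameter \<open>Z\<close> makes \<open>m\<close> an arbitrary representative of its class modulo \<open>z\<close>, so it can be
  taken with \<open>|m|\<^sup>2 \<le> |z|\<^sup>2 / 2\<close>, the square of the covering radius of the Gaussian lattice being
  \<open>1/2\<close>. Hence \<open>|z'| \<le> |z| / 2 + |a b| / |z|\<close>, which is less than \<open>|z|\<close> as soon as
  \<open>|z|\<^sup>2 > 2 |a b|\<close>. If \<open>x\<close> and \<open>y\<close> have a common prime factor, square-freeness of \<open>c\<close> forces it to
  divide \<open>z\<close> as well, and dividing it out makes a nonzero \<open>z\<close> smaller. So a nontrivial solution with \<open>|z|\<close>
  minimal has \<open>|z|\<^sup>2 \<le> 2 |a b|\<close>, and \<open>2 \<le> 1 + \<surd>2\<close>.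
\<close>

lemma coprime_imp_bezout:
  fixes x y :: "'a :: euclidean_ring"
  assumes "coprime x y"
  shows "\<exists>u v. u * x + v * y = 1"
  using assms
proof (induction "euclidean_size y" arbitrary: x y rule: less_induct)
  case less
  show ?case
  proof (cases "y = 0")
    case True
    then have "x dvd 1" using less.prems by simp
    then obtain u where "1 = x * u" by (elim dvdE)
    then have "u * x + 0 * y = 1" by (simp add: mult.commute)
    then show ?thesis by blast
  next
    case False
    have "coprime y (x mod y)"
      using less.prems by (auto simp: coprime_def dvd_mod_iff)
    then obtain u v where "u * y + v * (x mod y) = 1"
      using less.hyps[of "x mod y" y] mod_size_less[OF False] by blast
    then have "v * x + (u - v * (x div y)) * y = 1"
      by (simp add: minus_div_mult_eq_mod [symmetric] algebra_simps)
    then show ?thesis by blast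
  qed
qed

text \<open>
  The second intersection point is \<open>q (x, y, z) - 2 m (c v, - c u, Z)\<close>, where \<open>c q\<close> is the value of
  the form at the direction and \<open>c m\<close> the value of its bilinear form at the point and the direction.
  Outside characteristic 2 the vector vanishes only if \<open>q = m = 0\<close>, that is, if the direction is
  isotropic and orthogonal to the point; the formula for \<open>z z'\<close> then gives \<open>a b = 0\<close>, which expresses
  that a nondegenerate ternary form has no totally isotropic plane.
\<close>

lemma chord_point_solution:
  fixes a b c x y z u v Z :: "'a :: idom"
  assumes sol: "a * x\<^sup>2 + b * y\<^sup>2 + c * z\<^sup>2 = 0"
    and bezout: "u * x + v * y = 1"
    and m: "m = (a * v * x - b * u * y) + Z * z"
    and q: "q = c * (a * v\<^sup>2 + b * u\<^sup>2) + Z\<^sup>2"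
    and x': "x' = q * x - 2 * m * (c * v)"
    and y': "y' = q * y + 2 * m * (c * u)"
    and z': "z' = q * z - 2 * m * Z"
  shows "a * x'\<^sup>2 + b * y'\<^sup>2 + c * z'\<^sup>2 = 0"
    and "z * z' = - (m\<^sup>2 + a * b)"
    and "(2 :: 'a) \<noteq> 0 \<Longrightarrow> a \<noteq> 0 \<Longrightarrow> b \<noteq> 0 \<Longrightarrow> c \<noteq> 0 \<Longrightarrow> (x', y', z') \<noteq> (0, 0, 0)"
proof -
  have form: "a * (c * v)\<^sup>2 + b * (c * u)\<^sup>2 + c * Z\<^sup>2 = c * q"
    unfolding q by algebra
  have bilinear: "a * x * (c * v) - b * y * (c * u) + c * z * Z = c * m"
    unfolding m by algebra
  have "a * x'\<^sup>2 + b * y'\<^sup>2 + c * z'\<^sup>2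
      = q\<^sup>2 * (a * x\<^sup>2 + b * y\<^sup>2 + c * z\<^sup>2)
        - 4 * q * m * (a * x * (c * v) - b * y * (c * u) + c * z * Z)
        + 4 * m\<^sup>2 * (a * (c * v)\<^sup>2 + b * (c * u)\<^sup>2 + c * Z\<^sup>2)"
    unfolding x' y' z' by algebra
  also have "\<dots> = 0"
    unfolding sol form bilinear by algebra
  finally show "a * x'\<^sup>2 + b * y'\<^sup>2 + c * z'\<^sup>2 = 0" .

  \<comment> \<open>The Gram determinant of the binary form \<open>a x\<^sup>2 + b y\<^sup>2\<close> at \<open>(x, y)\<close> and \<open>(v, -u)\<close>.\<close>
  have "(a * v\<^sup>2 + b * u\<^sup>2) * (a * x\<^sup>2 + b * y\<^sup>2) - (a * v * x - b * u * y)\<^sup>2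
      = a * b * (u * x + v * y)\<^sup>2"
    by algebra
  moreover have "a * x\<^sup>2 + b * y\<^sup>2 = - (c * z\<^sup>2)"
    using sol by (simp add: eq_neg_iff_add_eq_0)
  ultimately have gram: "c * (a * v\<^sup>2 + b * u\<^sup>2) * z\<^sup>2 + (a * v * x - b * u * y)\<^sup>2 = - (a * b)"
    unfolding bezout by (simp, algebra)
  then show zz': "z * z' = - (m\<^sup>2 + a * b)"
    unfolding z' q m by algebra

  show "(x', y', z') \<noteq> (0, 0, 0)" if nz: "(2 :: 'a) \<noteq> 0" "a \<noteq> 0" "b \<noteq> 0" "c \<noteq> 0"
  proof
    assume "(x', y', z') = (0, 0, 0)"
    then have zero: "x' = 0" "y' = 0" "z' = 0" by simp_all
    \<comment> \<open>The functional \<open>(u, v)\<close> is 1 at \<open>(x, y)\<close> and kills the direction \<open>(c v, - c u)\<close>.\<close>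
    have "q = u * x' + v * y'"
      using bezout unfolding x' y' by algebra
    then have "q = 0" using zero by simp
    then have "m * v = 0" "m * u = 0"
      using zero nz unfolding x' y' by simp_all
    then have "m = 0" using bezout by auto
    then have "a * b = 0" using zz' zero by simp
    then show False using nz by simp
  qed
qed

lemma two_neq_zero_gauss_int: "(2 :: gauss_int) \<noteq> 0"
proof -
  have "complex_of_gauss (1 + 1) \<noteq> 0"
    unfolding complex_of_gauss_ring_hom by simp
  then show ?thesis by (metis complex_of_gauss_eq_0_iff one_add_one)
qed

text \<open>
  The square fundamental cell of the Gaussian lattice has half-diagonal \<open>1 / \<surd>2\<close>, whence the
  factor \<open>1/2\<close> between the squared moduli.
\<close>

lemma cmod_gauss_mod_le:
  assumes "v \<noteq> 0"
  shows "(cmod (complex_of_gauss (u mod v)))\<^sup>2 \<le> (cmod (complex_of_gauss v))\<^sup>2 / 2"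
proof -
  define q where "q = complex_of_gauss u / complex_of_gauss v"
  define d where "d = q - complex_of_gauss (u div v)"
  have "complex_of_gauss (u mod v) = d * complex_of_gauss v"
    using assms by (simp add: modulo_gauss_int_def d_def q_def field_simps)
  moreover have "\<bar>Re d\<bar> \<le> 1/2" "\<bar>Im d\<bar> \<le> 1/2"
    using of_int_round_abs_le[of "Re q"] of_int_round_abs_le[of "Im q"]
    by (simp_all add: d_def divide_gauss_int_def Let_def q_def complex_of_gauss_def
        abs_minus_commute)
  then have "(Re d)\<^sup>2 \<le> (1/2)\<^sup>2" "(Im d)\<^sup>2 \<le> (1/2)\<^sup>2"
    by (metis abs_ge_zero power2_abs power_mono)+
  then have "(cmod d)\<^sup>2 \<le> 1/2"
    unfolding cmod_power2 by (simp add: power_divide)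
  ultimately show ?thesis
    using mult_right_mono[of "(cmod d)\<^sup>2" "1/2" "(cmod (complex_of_gauss v))\<^sup>2"]
    by (simp add: norm_mult power_mult_distrib)
qed

lemma gauss_norm_less_iff:
  "gauss_norm u < gauss_norm v \<longleftrightarrow> cmod (complex_of_gauss u) < cmod (complex_of_gauss v)"
proof -
  have "gauss_norm u < gauss_norm v \<longleftrightarrow> real (gauss_norm u) < real (gauss_norm v)"
    by simp
  also have "\<dots> \<longleftrightarrow> cmod (complex_of_gauss u) < cmod (complex_of_gauss v)"
    unfolding gauss_norm_cmod by (metis norm_ge_zero power_mono_iff not_less zero_less_numeral)
  finally show ?thesis .
qed

text \<open>
  With \<open>m\<close> the remainder of \<open>a v x - b u y\<close> modulo \<open>z\<close>, the identity \<open>z z' = - (m\<^sup>2 + a b)\<close> gives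
  \<open>|z| |z'| \<le> |z|\<^sup>2 / 2 + |a b|\<close>, and the lower bound on \<open>|z|\<close> is exactly what puts the right-hand
  side below \<open>|z|\<^sup>2\<close>.
\<close>

lemma descend_of_coprime:
  fixes a b c x y z :: gauss_int
  assumes nz: "a \<noteq> 0" "b \<noteq> 0" "c \<noteq> 0"
    and sol: "a * x\<^sup>2 + b * y\<^sup>2 + c * z\<^sup>2 = 0"
    and "coprime x y"
    and large: "2 * cmod (complex_of_gauss (a * b)) < (cmod (complex_of_gauss z))\<^sup>2"
  shows "\<exists>x' y' z'. (x', y', z') \<noteq> (0, 0, 0) \<and> a * x'\<^sup>2 + b * y'\<^sup>2 + c * z'\<^sup>2 = 0 \<and>
           gauss_norm z' < gauss_norm z"
proof -
  have "z \<noteq> 0" using large by auto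
  obtain u v where bezout: "u * x + v * y = 1"
    using coprime_imp_bezout[OF \<open>coprime x y\<close>] by blast
  define s where "s = a * v * x - b * u * y"
  \<comment> \<open>The choice of \<open>Z\<close> that turns \<open>s + Z z\<close> into the remainder of \<open>s\<close> modulo \<open>z\<close>.\<close>
  define Z where "Z = - (s div z)"
  define m where "m = s mod z"
  define q where "q = c * (a * v\<^sup>2 + b * u\<^sup>2) + Z\<^sup>2"
  define x' where "x' = q * x - 2 * m * (c * v)"
  define y' where "y' = q * y + 2 * m * (c * u)"
  define z' where "z' = q * z - 2 * m * Z"
  have m: "m = (a * v * x - b * u * y) + Z * z"
    by (simp add: m_def Z_def s_def modulo_gauss_int_def)
  note chord = chord_point_solution[OF sol bezout m q_def x'_def y'_def z'_def]
  have "cmod (complex_of_gauss z) * cmod (complex_of_gauss z')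
      = cmod (complex_of_gauss m ^ 2 + complex_of_gauss (a * b))"
  proof -
    have "complex_of_gauss (z * z') = - (complex_of_gauss m ^ 2 + complex_of_gauss (a * b))"
      unfolding chord(2) by (simp add: power2_eq_square)
    then show ?thesis by (metis complex_of_gauss_ring_hom(6) norm_minus_cancel norm_mult)
  qed
  also have "\<dots> \<le> (cmod (complex_of_gauss m))\<^sup>2 + cmod (complex_of_gauss (a * b))"
    by (metis norm_power norm_triangle_ineq)
  also have "\<dots> < (cmod (complex_of_gauss z))\<^sup>2"
    using cmod_gauss_mod_le[OF \<open>z \<noteq> 0\<close>, of s] large unfolding m_def by linarith
  finally have "cmod (complex_of_gauss z') < cmod (complex_of_gauss z)"
    by (simp add: power2_eq_square mult_less_cancel_left)
  then show ?thesis
    using chord(1) chord(3)[OF two_neq_zero_gauss_int nz] by (metis gauss_norm_less_iff)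
qed

lemma squarefree_prime_sq_dvd_mult_sq:
  fixes p c z :: "'a :: idom_divide"
  assumes "prime_elem p" "squarefree c" "p\<^sup>2 dvd c * z\<^sup>2"
  shows "p dvd z"
proof (rule ccontr)
  assume "\<not> p dvd z"
  then have pz: "\<not> p dvd z\<^sup>2"
    using prime_elem_dvd_power[OF assms(1)] by blast
  have "p dvd c * z\<^sup>2"
    using assms(3) by (meson dvd_trans dvd_triv_left power2_eq_square dvd_power zero_less_numeral)
  then obtain e where e: "c = p * e"
    using pz prime_elem_dvd_multD[OF assms(1)] by blast
  have "p dvd e * z\<^sup>2"
    using assms(1,3) by (simp add: e power2_eq_square mult.assoc)
  then have "p dvd e"
    using pz prime_elem_dvd_multD[OF assms(1)] by blast
  then have "p\<^sup>2 dvd c"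
    by (simp add: e power2_eq_square)
  then show False
    using assms(1,2) by (auto simp: squarefree_def prime_elem_def)
qed

text \<open>
  A prime dividing both \<open>x\<close> and \<open>y\<close> has its square dividing \<open>c z\<^sup>2\<close>, so it divides \<open>z\<close> too and the
  whole solution can be divided by it.
\<close>

lemma descend_of_not_coprime:
  fixes a b c x y z :: gauss_int
  assumes "c \<noteq> 0" "squarefree c"
    and sol: "a * x\<^sup>2 + b * y\<^sup>2 + c * z\<^sup>2 = 0"
    and "\<not> coprime x y" and "z \<noteq> 0"
  shows "\<exists>x' y' z'. (x', y', z') \<noteq> (0, 0, 0) \<and> a * x'\<^sup>2 + b * y'\<^sup>2 + c * z'\<^sup>2 = 0 \<and>
           gauss_norm z' < gauss_norm z"
proof -
  obtain d where d: "d dvd x" "d dvd y" "\<not> d dvd 1"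
    using \<open>\<not> coprime x y\<close> by (auto simp: coprime_def)
  \<comment> \<open>Otherwise \<open>x = y = 0\<close>, and the equation would force \<open>z = 0\<close>.\<close>
  have "d \<noteq> 0"
    using d sol assms(1,5) by auto
  then obtain p where p: "prime_elem p" "p dvd d"
    using prime_dvd_gauss_int d(3) by blast
  obtain x' y' where xy: "x = p * x'" "y = p * y'"
    using d p(2) by (meson dvdE dvd_trans)
  have "c * z\<^sup>2 = p\<^sup>2 * (- (a * x'\<^sup>2 + b * y'\<^sup>2))"
    using sol unfolding xy by algebra
  then have "p dvd z"
    by (intro squarefree_prime_sq_dvd_mult_sq[OF p(1) assms(2)]) simp
  then obtain z' where z: "z = p * z'" by (elim dvdE)
  have "p\<^sup>2 * (a * x'\<^sup>2 + b * y'\<^sup>2 + c * z'\<^sup>2) = 0"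
    using sol unfolding xy z by algebra
  moreover have "p \<noteq> 0" using p(1) by auto
  ultimately have "a * x'\<^sup>2 + b * y'\<^sup>2 + c * z'\<^sup>2 = 0" by simp
  moreover have "z' \<noteq> 0" using z \<open>z \<noteq> 0\<close> by auto
  moreover have "gauss_norm z' < gauss_norm z"
  proof -
    have "\<not> p dvd 1" using p(1) by (simp add: prime_elem_def)
    then have "euclidean_size z' < euclidean_size (z' * p)"
      using \<open>z' \<noteq> 0\<close> \<open>p \<noteq> 0\<close> by (metis euclidean_size_times_nonunit mult.commute)
    then show ?thesis by (simp add: euclidean_size_gauss_int_def z mult.commute)
  qed
  ultimately show ?thesis by blast
qed

text \<open>
  A solution with \<open>z\<close> of minimal norm admits neither descent: the second shows that \<open>x\<close> and \<open>y\<close> are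
  coprime, and then the first bounds \<open>z\<close>. The constant 2 is the reciprocal of \<open>1 - 1/2\<close>, where \<open>1/2\<close>
  comes from rounding in the square lattice.
\<close>

lemma gauss_ternary_small_solution:
  fixes a b c :: gauss_int
  assumes "a \<noteq> 0" "b \<noteq> 0" "c \<noteq> 0" "squarefree c"
    and "\<exists>x y z. (x, y, z) \<noteq> (0, 0, 0) \<and> a * x\<^sup>2 + b * y\<^sup>2 + c * z\<^sup>2 = 0"
  shows "\<exists>x y z. (x, y, z) \<noteq> (0, 0, 0) \<and> a * x\<^sup>2 + b * y\<^sup>2 + c * z\<^sup>2 = 0 \<and>
           (cmod (complex_of_gauss z))\<^sup>2 \<le> 2 * cmod (complex_of_gauss (a * b))"
proof -
  let ?S = "\<lambda>x y z. (x, y, z) \<noteq> (0, 0, 0) \<and> a * x\<^sup>2 + b * y\<^sup>2 + c * z\<^sup>2 = 0"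
  obtain z where "\<exists>x y. ?S x y z"
    and min: "\<And>z'. \<exists>x y. ?S x y z' \<Longrightarrow> gauss_norm z \<le> gauss_norm z'"
    using ex_has_least_nat[of "\<lambda>z. \<exists>x y. ?S x y z" _ gauss_norm] assms(5) by metis
  then obtain x y where S: "?S x y z" by blast
  have stuck: "\<not> (\<exists>x' y' z'. ?S x' y' z' \<and> gauss_norm z' < gauss_norm z)"
    using min by (meson not_less)
  have "(cmod (complex_of_gauss z))\<^sup>2 \<le> 2 * cmod (complex_of_gauss (a * b))"
  proof (rule ccontr)
    assume "\<not> ?thesis"
    then have large: "2 * cmod (complex_of_gauss (a * b)) < (cmod (complex_of_gauss z))\<^sup>2"
      by simp
    then have "z \<noteq> 0" by auto
    then have "coprime x y"
      using descend_of_not_coprime[of c a x b y z] S stuck assms(3,4) by blast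
    then show False
      using descend_of_coprime[of a b c x y z] S large stuck assms(1-3) by blast
  qed
  then show ?thesis using S by blast
qed

theorem theorem1:
  fixes a b c :: gauss_int
  assumes "a \<noteq> 0" and "b \<noteq> 0" and "c \<noteq> 0"
    and "squarefree a" and "squarefree b" and "squarefree c"
    and "coprime a b" and "coprime b c" and "coprime a c"
    and "\<exists>x y z. (x, y, z) \<noteq> (0, 0, 0) \<and> a * x\<^sup>2 + b * y\<^sup>2 + c * z\<^sup>2 = 0"
  shows "\<exists>x y z. (x, y, z) \<noteq> (0, 0, 0) \<and> a * x\<^sup>2 + b * y\<^sup>2 + c * z\<^sup>2 = 0 \<and>
           cmod (complex_of_gauss z) \<le> sqrt ((1 + sqrt 2) * cmod (complex_of_gauss (a * b)))"
proof -
  obtain x y z where S: "(x, y, z) \<noteq> (0, 0, 0)" "a * x\<^sup>2 + b * y\<^sup>2 + c * z\<^sup>2 = 0"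
    and "(cmod (complex_of_gauss z))\<^sup>2 \<le> 2 * cmod (complex_of_gauss (a * b))"
    using gauss_ternary_small_solution[of a b c] assms by blast
  moreover have "2 * cmod (complex_of_gauss (a * b))
      \<le> (1 + sqrt 2) * cmod (complex_of_gauss (a * b))"
    by (intro mult_right_mono) simp_all
  ultimately have "cmod (complex_of_gauss z)
      \<le> sqrt ((1 + sqrt 2) * cmod (complex_of_gauss (a * b)))"
    by (intro real_le_rsqrt) linarith
  then show ?thesis using S by blast
qed

end
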